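(* In the setting of the context (with $T=1$), the control $\alpha^*\equiv 0$ is the unique equilibrium, where controls are identified if they agree Lebesgue-almost everywhere on $[0,T]$. That is: (a) the control $\alpha^*\equiv 0$ is an equilibrium; and (b) if $\alpha^*\in\mathcal{A}$ is any equilibrium, then $\alpha^*_t=0$ for Lebesgue-a.e. $t\in[0,T]$.
   Context: Let $T=1$. For $n\ge 0$ set $t_n := 1-2^{-n}$ and $s_n := \frac14[t_n+3t_{n+1}]$, so $t_n<s_n<t_{n+1}$. Let $$c(t) := \sum_{n=0}^\infty \big[\mathbf{1}_{[t_n,s_n)}(t)+6\,\mathbf{1}_{[s_n,t_{n+1})}(t)\big],\qquad t\in[0,T].$$ The admissible control set $\mathcal{A}$ is the set of all Borel measurable functions $\alpha:[0,1]\to[-1,1]$. For $\alpha\in\mathcal{A}$ and $t\in[0,T]$ define $$Y^{1,\alpha}_t := \int_t^T \alpha_s\,ds,\qquad Y^{2,\alpha}_t := \int_t^T c(s)\,\alpha_s\,Y^{1,\alpha}_s\,ds,\qquad J(t,\alpha) := Y^{2,\alpha}_t.$$ The cost $J(t,\cdot)$ is to be minimized over $\mathcal{A}$. Definition (equilibrium): $\alpha^*\in\mathcal{A}$ is an equilibrium if for every $t\in[0,T)$ and every $\alpha\in\mathcal{A}$, $$\liminf_{\delta\downarrow 0}\frac1\delta\big[J(t,\alpha\oplus_{t+\delta}\alpha^* )-J(t,\alpha^* )\big]\ge 0,\qquad\text{where } \alpha\oplus_{t+\delta}\alpha^* := \alpha\,\mathbf{1}_{[0,t+\delta)}+\alpha^*\,\mathbf{1}_{[t+\delta,T]}$$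 (with $0<\delta\le T-t$). *)

theory Defs
  imports "HOL-Analysis.Analysis"
begin

text \<open>The time horizon is $T = 1$ throughout.\<close>

definition t_grid :: "nat \<Rightarrow> real" where
  "t_grid n = 1 - 1 / 2 ^ n"

definition s_grid :: "nat \<Rightarrow> real" where
  "s_grid n = (t_grid n + 3 * t_grid (Suc n)) / 4"

text \<open>The intervals partition $[0,1)$, so at most one summand is nonzero at each point and the
  series always converges; at time \<open>1\<close> its value is \<open>0\<close>.\<close>

definition c_weight :: "real \<Rightarrow> real" where
  "c_weight t = (\<Sum>n. indicator {t_grid n ..< s_grid n} t
                     + 6 * indicator {s_grid n ..< t_grid (Suc n)} t)"

text \<open>A control on $[0,1]$ is represented by a total function whose values outside $[0,1]$ are
  arbitrary. Nothing below depends on those values.\<close>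

definition admissible :: "(real \<Rightarrow> real) set" where
  "admissible = (restrict_space borel {0..1} \<rightarrow>\<^sub>M restrict_space borel {-1..1})"

definition Y1 :: "(real \<Rightarrow> real) \<Rightarrow> real \<Rightarrow> real" where
  "Y1 \<alpha> t = (LINT s:{t..1}|lborel. \<alpha> s)"

definition Y2 :: "(real \<Rightarrow> real) \<Rightarrow> real \<Rightarrow> real" where
  "Y2 \<alpha> t = (LINT s:{t..1}|lborel. c_weight s * \<alpha> s * Y1 \<alpha> s)"

definition J :: "real \<Rightarrow> (real \<Rightarrow> real) \<Rightarrow> real" where
  "J t \<alpha> = Y2 \<alpha> t"

definition concat_at :: "real \<Rightarrow> (real \<Rightarrow> real) \<Rightarrow> (real \<Rightarrow> real) \<Rightarrow> real \<Rightarrow> real" where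
  "concat_at u \<alpha> \<beta> = (\<lambda>s. \<alpha> s * indicator {0..<u} s + \<beta> s * indicator {u..1} s)"

text \<open>The limit inferior is taken in the extended reals. The constraint $\delta \le 1 - t$ holds
  eventually as $\delta \downarrow 0$, since $t < 1$, and so does not appear.\<close>

definition equilibrium :: "(real \<Rightarrow> real) \<Rightarrow> bool" where
  "equilibrium \<alpha>' \<longleftrightarrow> \<alpha>' \<in> admissible \<and>
     (\<forall>t\<in>{0..<1}. \<forall>\<alpha>\<in>admissible.
        Liminf (at_right 0)
          (\<lambda>\<delta>. ereal (1 / \<delta> * (J t (concat_at (t + \<delta>) \<alpha> \<alpha>') - J t \<alpha>'))) \<ge> 0)"

end

theory Submission
  imports Defs
begin

text \<open>
  Write \<open>y = Y1 \<alpha>\<close> for the first state of a control \<open>\<alpha>\<close>. It is Lipschitz with constant 1, and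
  \<open>y 1 = 0\<close>. Replacing \<open>\<alpha>\<close> by a control \<open>\<beta>\<close> on \<open>[t, t + \<delta>)\<close> leaves both states unchanged from
  \<open>t + \<delta>\<close> on and moves the first state by at most \<open>2\<delta>\<close> on \<open>[t, t + \<delta>)\<close>. As the weight is bounded,
  \<open>J_concat_at_diff\<close> shows that the cost changes by
  \[ \int_t^{t+\delta} c(s)\,(\beta_s - \alpha_s)\,y_s\,ds + O(\delta^2). \]

  For \<open>\<alpha> = 0\<close> the integral vanishes because \<open>y = 0\<close>, so the difference quotients tend to \<open>0\<close> and
  the zero control is an equilibrium.

  Conversely, let \<open>\<alpha>\<close> be an equilibrium. If \<open>y\<close> takes a positive value, it attains its maximum over
  \<open>[0,1]\<close> at some \<open>m < 1\<close>, with \<open>y m > 0\<close>. Deviate at \<open>m\<close> to the constant control \<open>-1\<close>. By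
  maximality \<open>\<alpha>\<close> has a nonnegative integral over \<open>[m, m + \<delta>)\<close>, so \<open>1 + \<alpha>\<close>, which is nonnegative,
  has integral at least \<open>\<delta>\<close> there. Since the weight is at least \<open>1\<close> before time \<open>1\<close>, and
  \<open>y \<ge> y m / 2\<close> near \<open>m\<close>, the cost drops by at least \<open>\<delta> y m / 2 - O(\<delta>\<^sup>2)\<close>, which contradicts the
  equilibrium property. Hence \<open>y \<le> 0\<close> (\<open>equilibrium_Y1_nonpos\<close>). The cost is invariant under
  changing the sign of the control, so \<open>- \<alpha>\<close> is an equilibrium too and \<open>y = 0\<close> on \<open>[0,1]\<close>. Thus
  every tail integral of \<open>\<alpha>\<close> vanishes, which forces \<open>\<alpha> = 0\<close> almost everywhere
  (\<open>AE_eq_0_if_tail_integrals_0\<close>).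
\<close>

section \<open>The weight\<close>

lemma t_grid_mono: "m \<le> n \<Longrightarrow> t_grid m \<le> t_grid n"
  unfolding t_grid_def by (simp add: frac_le)

lemma t_grid_le_s_grid: "t_grid n \<le> s_grid n"
  and s_grid_le_t_grid_Suc: "s_grid n \<le> t_grid (Suc n)"
  using t_grid_mono[of n "Suc n"] unfolding s_grid_def by auto

lemma ex_t_grid_interval:
  assumes "0 \<le> t" "t < 1"
  obtains n where "t_grid n \<le> t" "t < t_grid (Suc n)"
proof -
  obtain m where "(1 / 2 :: real) ^ m < 1 - t"
    using real_arch_pow_inv[of "1 - t" "1/2"] assms by auto
  then have ex: "t < t_grid m"
    by (simp add: t_grid_def power_one_over)
  define k where "k = (LEAST m. t < t_grid m)"
  have k: "t < t_grid k"
    unfolding k_def using ex by (rule LeastI)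
  have "k \<noteq> 0"
    using k assms(1) by (auto simp: t_grid_def intro!: Nat.gr0I)
  then obtain n where n: "k = Suc n"
    using not0_implies_Suc by blast
  then have "\<not> t < t_grid n"
    using not_less_Least[of n "\<lambda>m. t < t_grid m"] k_def by auto
  then show thesis
    using k n that[of n] by auto
qed

lemma c_weight_bounds:
  assumes "0 \<le> t" "t < 1"
  shows "1 \<le> c_weight t" "c_weight t \<le> 6"
proof -
  obtain n where n: "t_grid n \<le> t" "t < t_grid (Suc n)"
    using ex_t_grid_interval[OF assms] .
  let ?f = "\<lambda>n. indicator {t_grid n ..< s_grid n} t
                 + 6 * indicator {s_grid n ..< t_grid (Suc n)} t :: real"
  have zero: "?f m = 0" if "m \<noteq> n" for m
  proof (cases "m < n")
    case True
    then have "t_grid (Suc m) \<le> t"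
      using t_grid_mono[of "Suc m" n] n by auto
    then show ?thesis
      using s_grid_le_t_grid_Suc[of m] by (auto simp: indicator_def)
  next
    case False
    then have "t < t_grid m"
      using t_grid_mono[of "Suc n" m] that n by auto
    then show ?thesis
      using t_grid_le_s_grid[of m] by (auto simp: indicator_def)
  qed
  have "c_weight t = sum ?f {n}"
    unfolding c_weight_def by (rule suminf_finite) (use zero in blast)+
  then have "c_weight t = ?f n"
    by simp
  moreover have "?f n = 1 \<or> ?f n = 6"
    using n by (auto simp: indicator_def)
  ultimately show "1 \<le> c_weight t" "c_weight t \<le> 6"
    by auto
qed

lemma c_weight_one: "c_weight 1 = 0"
proof -
  have t: "t_grid n \<le> 1" for n
    by (simp add: t_grid_def)
  have s: "s_grid n \<le> 1" for n
    using s_grid_le_t_grid_Suc[of n] t by (rule order_trans)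
  show ?thesis
    unfolding c_weight_def by (simp add: indicator_def leD[OF t] leD[OF s])
qed

lemma c_weight_abs_le: "s \<in> {0..1} \<Longrightarrow> \<bar>c_weight s\<bar> \<le> 6"
  using c_weight_bounds[of s] c_weight_one by (cases "s = 1") auto

lemma borel_measurable_c_weight [measurable]: "c_weight \<in> borel_measurable borel"
  unfolding c_weight_def by measurable

section \<open>Integration of bounded functions\<close>

lemma set_integrable_bounded:
  fixes f :: "real \<Rightarrow> real"
  assumes "set_borel_measurable lborel {0..1} f" "\<And>s. s \<in> {0..1} \<Longrightarrow> \<bar>f s\<bar> \<le> B"
    and "A \<in> sets borel" "A \<subseteq> {0..1}"
  shows "set_integrable lborel A f"
proof -
  have "set_integrable lborel {0..1::real} (\<lambda>_. B)"
    unfolding set_integrable_def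
    by (intro integrable_scaleR_left integrable_real_indicator) auto
  then have "set_integrable lborel {0..1} f"
    by (rule set_integrable_bound)
       (use assms(1,2) in \<open>auto intro: order_trans[OF _ abs_ge_self]\<close>)
  then show ?thesis
    by (rule set_integrable_subset) (use assms(3,4) in auto)
qed

lemma set_borel_measurable_mult:
  fixes f g :: "real \<Rightarrow> real"
  assumes "set_borel_measurable lborel A f" "set_borel_measurable lborel A g"
  shows "set_borel_measurable lborel A (\<lambda>s. f s * g s)"
proof -
  have "(\<lambda>s. (indicator A s *\<^sub>R f s) * (indicator A s *\<^sub>R g s)) \<in> borel_measurable lborel"
    using assms unfolding set_borel_measurable_def by (rule borel_measurable_times)
  also have "(\<lambda>s. (indicator A s *\<^sub>R f s) * (indicator A s *\<^sub>R g s))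
      = (\<lambda>s. indicator A s *\<^sub>R (f s * g s))"
    by (auto simp: indicator_def)
  finally show ?thesis
    unfolding set_borel_measurable_def .
qed

lemma set_integral_le_const:
  fixes f :: "real \<Rightarrow> real"
  assumes "set_integrable lborel {a..<b} f" "a \<le> b" "\<And>s. s \<in> {a..<b} \<Longrightarrow> f s \<le> K"
  shows "(LINT s:{a..<b}|lborel. f s) \<le> K * (b - a)"
proof -
  have "set_integrable lborel {a..<b} (\<lambda>_. K)"
    unfolding set_integrable_def using assms(2)
    by (intro integrable_scaleR_left integrable_real_indicator) auto
  then have "(LINT s:{a..<b}|lborel. f s) \<le> (LINT s:{a..<b}|lborel. K)"
    using assms by (intro set_integral_mono) auto
  also have "\<dots> = K * (b - a)"
    using assms(2) by (simp add: set_integral_const mult.commute)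
  finally show ?thesis .
qed

lemma set_integral_abs_le_const:
  fixes f :: "real \<Rightarrow> real"
  assumes f: "set_integrable lborel {a..<b} f" and "a \<le> b" "\<And>s. s \<in> {a..<b} \<Longrightarrow> \<bar>f s\<bar> \<le> K"
  shows "\<bar>LINT s:{a..<b}|lborel. f s\<bar> \<le> K * (b - a)"
proof -
  have "(LINT s:{a..<b}|lborel. f s) \<le> K * (b - a)"
    using assms by (intro set_integral_le_const) (auto simp: abs_le_iff)
  moreover have "(LINT s:{a..<b}|lborel. - f s) \<le> K * (b - a)"
    using assms
    by (intro set_integral_le_const)
       (auto simp: abs_le_iff set_integrable_def)
  ultimately show ?thesis
    using set_integral_uminus[OF f] by linarith
qed

lemma set_integral_split:
  fixes f :: "real \<Rightarrow> real"
  assumes "set_integrable lborel {s..<u} f" "set_integrable lborel {u..v} f" "s \<le> u" "u \<le> v"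
  shows "(LINT r:{s..v}|lborel. f r)
      = (LINT r:{s..<u}|lborel. f r) + (LINT r:{u..v}|lborel. f r)"
proof -
  have split: "{s..v} = {s..<u} \<union> {u..v}" and disj: "{s..<u} \<inter> {u..v} = {}"
    using assms(3,4) by auto
  show ?thesis
    unfolding split using disj assms(1,2) by (rule set_integral_Un)
qed

text \<open>The positive and the negative part of \<open>f\<close> are densities of finite measures that agree on all
  upper half-lines; hence the measures are equal, and so are the densities.\<close>

lemma AE_eq_0_if_tail_integrals_0:
  fixes f :: "real \<Rightarrow> real"
  assumes f: "integrable lborel f" and zero: "\<And>x. (LINT s:{x<..}|lborel. f s) = 0"
  shows "AE s in lborel. f s = 0"
proof -
  let ?p = "\<lambda>s. max (f s) 0" and ?n = "\<lambda>s. max (- f s) 0"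
  have [measurable]: "f \<in> borel_measurable borel"
    using f borel_measurable_integrable by fastforce
  have p: "integrable lborel ?p" and n: "integrable lborel ?n"
    using f by auto
  have fin: "emeasure (density lborel (\<lambda>s. ennreal (g s))) A
      = ennreal (LINT s:A|lborel. g s)"
    if "integrable lborel g" "\<And>s. 0 \<le> g s" "A \<in> sets borel" for g :: "real \<Rightarrow> real" and A
  proof -
    have "emeasure (density lborel (\<lambda>s. ennreal (g s))) A
        = (\<integral>\<^sup>+ s. ennreal (g s) * indicator A s \<partial>lborel)"
      using that by (intro emeasure_density) auto
    also have "\<dots> = (\<integral>\<^sup>+ s. ennreal (indicator A s *\<^sub>R g s) \<partial>lborel)"
      by (intro nn_integral_cong) (auto simp: indicator_def)
    also have "\<dots> = ennreal (LINT s:A|lborel. g s)"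
      unfolding set_lebesgue_integral_def using that
      by (intro nn_integral_eq_integral integrable_mult_indicator) auto
    finally show ?thesis .
  qed
  have eq: "(LINT s:{x<..}|lborel. ?p s) = (LINT s:{x<..}|lborel. ?n s)" for x
  proof -
    have "set_integrable lborel {x<..} ?p" "set_integrable lborel {x<..} ?n"
      unfolding set_integrable_def by (intro integrable_mult_indicator p n; simp)+
    then have "(LINT s:{x<..}|lborel. ?p s - ?n s)
        = (LINT s:{x<..}|lborel. ?p s) - (LINT s:{x<..}|lborel. ?n s)"
      by (rule set_integral_diff(2))
    moreover have "(\<lambda>s. ?p s - ?n s) = f"
      by (auto simp: max_def)
    ultimately show ?thesis
      using zero[of x] by simp
  qed
  have "density lborel (\<lambda>s. ennreal (?p s)) = density lborel (\<lambda>s. ennreal (?n s))"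
    by (rule measure_eqI_lessThan) (simp_all add: fin p n eq)
  moreover have "(\<integral>\<^sup>+ s. ennreal (?p s) \<partial>lborel) \<noteq> \<infinity>"
    using nn_integral_eq_integral[OF p] by simp
  ultimately have "AE s in lborel. ennreal (?p s) = ennreal (?n s)"
    by (subst (asm) finite_density_unique) auto
  then show ?thesis
    by eventually_elim (auto simp: max_def split: if_splits)
qed

section \<open>Admissible controls and their states\<close>

lemma admissible_iff:
  "\<alpha> \<in> admissible \<longleftrightarrow>
     set_borel_measurable lborel {0..1} \<alpha> \<and> (\<forall>s\<in>{0..1}. \<bar>\<alpha> s\<bar> \<le> 1)"
proof -
  have "\<alpha> \<in> admissible \<longleftrightarrow>
     \<alpha> \<in> borel_measurable (restrict_space borel {0..1}) \<and> (\<forall>s\<in>{0..1}. \<alpha> s \<in> {-1..1})"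
    unfolding admissible_def by (auto simp: measurable_restrict_space2_iff space_restrict_space)
  also have "\<alpha> \<in> borel_measurable (restrict_space borel {0..1})
     \<longleftrightarrow> set_borel_measurable lborel {0..1} \<alpha>"
    unfolding set_borel_measurable_def
    by (subst borel_measurable_restrict_space_iff) (auto simp: mult.commute)
  finally show ?thesis
    by (auto simp: abs_le_iff)
qed

lemma admissible_set_integrable:
  assumes "\<alpha> \<in> admissible" "A \<in> sets borel" "A \<subseteq> {0..1}"
  shows "set_integrable lborel A \<alpha>"
  using assms by (intro set_integrable_bounded[where B = 1]) (auto simp: admissible_iff)

lemma Y1_split:
  assumes "\<alpha> \<in> admissible" "0 \<le> s" "s \<le> u" "u \<le> 1"
  shows "Y1 \<alpha> s = (LINT r:{s..<u}|lborel. \<alpha> r) + Y1 \<alpha> u"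
  unfolding Y1_def using assms
  by (intro set_integral_split admissible_set_integrable) auto

lemma Y1_lipschitz:
  assumes "\<alpha> \<in> admissible" "0 \<le> s" "s \<le> u" "u \<le> 1"
  shows "\<bar>Y1 \<alpha> s - Y1 \<alpha> u\<bar> \<le> u - s"
proof -
  have "\<bar>LINT r:{s..<u}|lborel. \<alpha> r\<bar> \<le> 1 * (u - s)"
    using assms
    by (intro set_integral_abs_le_const admissible_set_integrable) (auto simp: admissible_iff)
  then show ?thesis
    using Y1_split[OF assms] by simp
qed

lemma Y1_at_1: "Y1 \<alpha> 1 = 0"
proof -
  have "AE s in lborel. indicator {1..1::real} s *\<^sub>R \<alpha> s = 0"
    using AE_lborel_singleton[of "1::real"] by eventually_elim simp
  then show ?thesis
    unfolding Y1_def set_lebesgue_integral_def by (rule integral_eq_zero_AE)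
qed

lemma Y1_abs_le:
  assumes "\<alpha> \<in> admissible" "s \<in> {0..1}"
  shows "\<bar>Y1 \<alpha> s\<bar> \<le> 1"
  using Y1_lipschitz[of \<alpha> s 1] Y1_at_1 assms by auto

lemma continuous_on_Y1:
  assumes "\<alpha> \<in> admissible"
  shows "continuous_on {0..1} (Y1 \<alpha>)"
proof (rule continuous_onI)
  fix x e :: real
  assume x: "x \<in> {0..1}" and "0 < e"
  have "dist (Y1 \<alpha> y) (Y1 \<alpha> x) \<le> e" if "y \<in> {0..1}" "dist y x < e" for y
    using Y1_lipschitz[OF assms, of x y] Y1_lipschitz[OF assms, of y x] x that
    by (cases "x \<le> y") (auto simp: dist_real_def)
  then show "\<exists>d>0. \<forall>y\<in>{0..1}. dist y x < d \<longrightarrow> dist (Y1 \<alpha> y) (Y1 \<alpha> x) \<le> e"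
    using \<open>0 < e\<close> by blast
qed

lemma cost_density_set_integrable:
  assumes "\<alpha> \<in> admissible" "A \<in> sets borel" "A \<subseteq> {0..1}"
  shows "set_integrable lborel A (\<lambda>s. c_weight s * \<alpha> s * Y1 \<alpha> s)"
proof (rule set_integrable_bounded[where B = 6])
  have "set_borel_measurable lborel {0..1} (Y1 \<alpha>)"
    using borel_measurable_continuous_on_indicator[OF _ continuous_on_Y1[OF assms(1)]]
    unfolding set_borel_measurable_def by simp
  moreover have "set_borel_measurable lborel {0..1} c_weight"
    unfolding set_borel_measurable_def by measurable
  ultimately show "set_borel_measurable lborel {0..1} (\<lambda>s. c_weight s * \<alpha> s * Y1 \<alpha> s)"
    using assms(1) by (intro set_borel_measurable_mult) (auto simp: admissible_iff)
  fix s :: real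
  assume s: "s \<in> {0..1}"
  have "\<bar>c_weight s\<bar> * \<bar>\<alpha> s\<bar> * \<bar>Y1 \<alpha> s\<bar> \<le> 6 * 1 * 1"
    using s assms(1) Y1_abs_le[OF assms(1) s] c_weight_abs_le[OF s]
    by (intro mult_mono) (auto simp: admissible_iff)
  then show "\<bar>c_weight s * \<alpha> s * Y1 \<alpha> s\<bar> \<le> 6"
    by (simp add: abs_mult)
qed (use assms in auto)

lemma Y2_split:
  assumes "\<alpha> \<in> admissible" "0 \<le> s" "s \<le> u" "u \<le> 1"
  shows "Y2 \<alpha> s = (LINT r:{s..<u}|lborel. c_weight r * \<alpha> r * Y1 \<alpha> r) + Y2 \<alpha> u"
  unfolding Y2_def using assms
  by (intro set_integral_split cost_density_set_integrable) auto

section \<open>Deviating on a short interval\<close>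

lemma concat_at_simps:
  "s \<in> {0..<u} \<Longrightarrow> concat_at u \<alpha> \<beta> s = \<alpha> s"
  "s \<in> {u..1} \<Longrightarrow> concat_at u \<alpha> \<beta> s = \<beta> s"
  by (auto simp: concat_at_def)

text \<open>No upper bound on \<open>u\<close> is needed: if \<open>u > 1\<close>, the concatenation is \<open>\<alpha>\<close> on \<open>[0,1]\<close>.\<close>

lemma concat_at_admissible:
  assumes "\<alpha> \<in> admissible" "\<beta> \<in> admissible" "0 \<le> u"
  shows "concat_at u \<alpha> \<beta> \<in> admissible"
proof -
  let ?f = "\<lambda>s. indicator {..<u} s *\<^sub>R (indicator {0..1} s *\<^sub>R \<alpha> s)
      + indicator {u..} s *\<^sub>R (indicator {0..1} s *\<^sub>R \<beta> s) :: real"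
  have meas: "(\<lambda>s. indicator {0..1} s *\<^sub>R \<alpha> s) \<in> borel_measurable lborel"
    "(\<lambda>s. indicator {0..1} s *\<^sub>R \<beta> s) \<in> borel_measurable lborel"
    using assms(1,2) by (simp_all only: admissible_iff set_borel_measurable_def)
  have "?f \<in> borel_measurable lborel"
    by (intro borel_measurable_add borel_measurable_scaleR meas borel_measurable_indicator) simp_all
  moreover have "?f s = indicator {0..1} s *\<^sub>R concat_at u \<alpha> \<beta> s" for s
    using assms(3)
    by (cases "s \<in> {0..1}"; cases "s < u") (simp_all add: concat_at_def)
  ultimately have "set_borel_measurable lborel {0..1} (concat_at u \<alpha> \<beta>)"
    unfolding set_borel_measurable_def by simp
  moreover have "\<bar>concat_at u \<alpha> \<beta> s\<bar> \<le> 1" if "s \<in> {0..1}" for s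
    using assms that by (cases "s < u") (auto simp: concat_at_simps admissible_iff)
  ultimately show ?thesis
    by (auto simp: admissible_iff)
qed

lemma Y1_concat_at:
  assumes "u \<le> s"
  shows "Y1 (concat_at u \<alpha> \<beta>) s = Y1 \<beta> s"
  unfolding Y1_def using assms
  by (intro set_lebesgue_integral_cong) (auto simp: concat_at_simps)

lemma Y2_concat_at: "Y2 (concat_at u \<alpha> \<beta>) u = Y2 \<beta> u"
  unfolding Y2_def
  by (intro set_lebesgue_integral_cong) (auto simp: concat_at_simps Y1_concat_at)

text \<open>The states of \<open>\<gamma>\<close> and \<open>\<beta>\<close> agree from time \<open>u\<close> on, so only \<open>[t, u)\<close> contributes to the change of
  the cost.\<close>

lemma J_concat_at_diff:
  assumes "\<alpha> \<in> admissible" "\<beta> \<in> admissible" "0 \<le> t" "t \<le> u" "u \<le> 1"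
  defines "\<gamma> \<equiv> concat_at u \<alpha> \<beta>"
  shows "set_integrable lborel {t..<u}
           (\<lambda>s. c_weight s * (\<alpha> s * Y1 \<gamma> s - \<beta> s * Y1 \<beta> s))" (is ?int)
    and "J t \<gamma> - J t \<beta>
      = (LINT s:{t..<u}|lborel. c_weight s * (\<alpha> s * Y1 \<gamma> s - \<beta> s * Y1 \<beta> s))" (is ?eq)
proof -
  have \<gamma>: "\<gamma> \<in> admissible"
    unfolding \<gamma>_def using assms by (intro concat_at_admissible) auto
  let ?h = "\<lambda>\<alpha> s. c_weight s * \<alpha> s * Y1 \<alpha> s"
  have int: "set_integrable lborel {t..<u} (?h \<gamma>)" "set_integrable lborel {t..<u} (?h \<beta>)"
    using \<gamma> assms by (auto intro!: cost_density_set_integrable)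
  have cong: "?h \<gamma> s - ?h \<beta> s = c_weight s * (\<alpha> s * Y1 \<gamma> s - \<beta> s * Y1 \<beta> s)"
    if "s \<in> {t..<u}" for s
    using that assms(3) by (simp add: \<gamma>_def concat_at_simps algebra_simps)
  have "set_integrable lborel {t..<u} (\<lambda>s. ?h \<gamma> s - ?h \<beta> s)"
    using int by (rule set_integral_diff(1))
  then show ?int
    by (rule iffD1[OF set_integrable_cong[OF refl refl cong], rotated])
  have "J t \<gamma> - J t \<beta> = (LINT s:{t..<u}|lborel. ?h \<gamma> s) - (LINT s:{t..<u}|lborel. ?h \<beta> s)"
    using Y2_split[OF \<gamma> assms(3-5)] Y2_split[OF assms(2-5)] Y2_concat_at[of u \<alpha> \<beta>]
    unfolding J_def \<gamma>_def by simp
  also have "\<dots> = (LINT s:{t..<u}|lborel. ?h \<gamma> s - ?h \<beta> s)"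
    using int by (rule set_integral_diff(2)[symmetric])
  also have "\<dots> = (LINT s:{t..<u}|lborel. c_weight s * (\<alpha> s * Y1 \<gamma> s - \<beta> s * Y1 \<beta> s))"
    using cong by (intro set_lebesgue_integral_cong) auto
  finally show ?eq .
qed

section \<open>The zero control is an equilibrium\<close>

lemma zero_admissible: "(\<lambda>_. 0) \<in> admissible"
  by (simp add: admissible_iff set_borel_measurable_def)

lemma equilibrium_zero: "equilibrium (\<lambda>_. 0)"
  unfolding equilibrium_def
proof (intro conjI ballI)
  fix t :: real and \<alpha>
  assume t: "t \<in> {0..<1}" and \<alpha>: "\<alpha> \<in> admissible"
  let ?D = "\<lambda>\<delta>. 1 / \<delta> * (J t (concat_at (t + \<delta>) \<alpha> (\<lambda>_. 0)) - J t (\<lambda>_. 0))"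
  have bound: "\<bar>?D \<delta>\<bar> \<le> 6 * \<delta>" if \<delta>: "0 < \<delta>" "\<delta> < 1 - t" for \<delta>
  proof -
    let ?u = "t + \<delta>"
    let ?\<gamma> = "concat_at ?u \<alpha> (\<lambda>_. 0)"
    have \<gamma>: "?\<gamma> \<in> admissible"
      using \<alpha> zero_admissible t \<delta> by (intro concat_at_admissible) auto
    have Y0: "Y1 (\<lambda>_. 0) s = 0" for s
      by (simp add: Y1_def)
    have "\<bar>c_weight s * (\<alpha> s * Y1 ?\<gamma> s - 0 * Y1 (\<lambda>_. 0) s)\<bar> \<le> 6 * \<delta>"
      if s: "s \<in> {t..<?u}" for s
    proof -
      have "\<bar>Y1 ?\<gamma> s\<bar> \<le> \<delta>"
        using Y1_lipschitz[OF \<gamma>, of s ?u] Y1_concat_at[of ?u ?u \<alpha> "\<lambda>_. 0"] Y0 s t \<delta> by auto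
      then have "\<bar>c_weight s\<bar> * (\<bar>\<alpha> s\<bar> * \<bar>Y1 ?\<gamma> s\<bar>) \<le> 6 * (1 * \<delta>)"
        using c_weight_abs_le[of s] \<alpha> s t \<delta> by (intro mult_mono) (auto simp: admissible_iff)
      then show ?thesis
        by (simp add: abs_mult)
    qed
    then have "\<bar>J t ?\<gamma> - J t (\<lambda>_. 0)\<bar> \<le> 6 * \<delta> * (?u - t)"
      using J_concat_at_diff[OF \<alpha> zero_admissible, of t ?u] t \<delta>
        set_integral_abs_le_const[of t ?u "\<lambda>s. c_weight s * (\<alpha> s * Y1 ?\<gamma> s - 0 * Y1 (\<lambda>_. 0) s)"]
      by auto
    then show ?thesis
      using \<delta> by (simp add: abs_mult field_simps)
  qed
  have "((\<lambda>\<delta>. 6 * \<delta>) \<longlongrightarrow> 6 * 0) (at_right (0::real))"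
    by (intro tendsto_intros)
  moreover have "\<forall>\<^sub>F \<delta> in at_right 0. \<delta> \<in> {0 <..< 1 - t}"
    using t by (intro eventually_at_right_real) auto
  then have "\<forall>\<^sub>F \<delta> in at_right 0. \<bar>?D \<delta>\<bar> \<le> 6 * \<delta>"
    by (rule eventually_mono) (intro bound; simp)
  ultimately have "(?D \<longlongrightarrow> 0) (at_right 0)"
    using Lim_null_comparison[of ?D "\<lambda>\<delta>. 6 * \<delta>"] by simp
  then have "((\<lambda>\<delta>. ereal (?D \<delta>)) \<longlongrightarrow> ereal 0) (at_right 0)"
    by (rule tendsto_ereal)
  then have "Liminf (at_right 0) (\<lambda>\<delta>. ereal (?D \<delta>)) = ereal 0"
    by (intro lim_imp_Liminf) auto
  then show "0 \<le> Liminf (at_right 0) (\<lambda>\<delta>. ereal (?D \<delta>))"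
    by simp
qed (rule zero_admissible)

section \<open>Every equilibrium vanishes\<close>

text \<open>At a positive maximum of the first state, deviating to the constant control \<open>-1\<close> lowers the cost
  at first order.\<close>

lemma equilibrium_Y1_nonpos:
  assumes eq: "equilibrium \<alpha>" and "s \<in> {0..1}"
  shows "Y1 \<alpha> s \<le> 0"
proof (rule ccontr)
  assume pos: "\<not> Y1 \<alpha> s \<le> 0"
  have \<alpha>: "\<alpha> \<in> admissible"
    using eq by (simp add: equilibrium_def)
  obtain m where m: "m \<in> {0..1}" and max: "\<And>r. r \<in> {0..1} \<Longrightarrow> Y1 \<alpha> r \<le> Y1 \<alpha> m"
    using continuous_attains_sup[OF _ _ continuous_on_Y1[OF \<alpha>]] by auto
  define y where "y = Y1 \<alpha> m"
  have y: "0 < y"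
    using pos max[OF assms(2)] by (simp add: y_def)
  with m have m1: "m \<in> {0..<1}"
    using Y1_at_1[of \<alpha>] y_def by (cases "m = 1") auto
  let ?a = "\<lambda>_. -1 :: real"
  have a: "?a \<in> admissible"
    by (simp add: admissible_iff set_borel_measurable_def)
  have bound: "1 / \<delta> * (J m (concat_at (m + \<delta>) ?a \<alpha>) - J m \<alpha>) \<le> 12 * \<delta> - y / 2"
    if \<delta>: "0 < \<delta>" "\<delta> < 1 - m" "\<delta> < y / 2" for \<delta>
  proof -
    let ?u = "m + \<delta>"
    let ?\<gamma> = "concat_at ?u ?a \<alpha>"
    let ?f = "\<lambda>s. c_weight s * (?a s * Y1 ?\<gamma> s - \<alpha> s * Y1 \<alpha> s)"
    have \<gamma>: "?\<gamma> \<in> admissible"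
      using \<alpha> a m \<delta> by (intro concat_at_admissible) auto
    have int\<alpha>: "set_integrable lborel {m..<?u} \<alpha>"
      using \<alpha> m \<delta> by (intro admissible_set_integrable) auto
    then have int: "set_integrable lborel {m..<?u} (\<lambda>s. ?f s + y / 2 * \<alpha> s)"
      using J_concat_at_diff(1)[OF a \<alpha>, of m ?u] m \<delta> by auto
    \<comment> \<open>Adding \<open>y / 2 * \<alpha> s\<close> absorbs the unknown control, so that the bound is a constant.\<close>
    have "?f s + y / 2 * \<alpha> s \<le> 12 * \<delta> - y / 2" if s: "s \<in> {m..<?u}" for s
    proof -
      have near: "Y1 \<alpha> s - 2 * \<delta> \<le> Y1 ?\<gamma> s" "y / 2 \<le> Y1 \<alpha> s"
        using Y1_lipschitz[OF \<gamma>, of s ?u] Y1_lipschitz[OF \<alpha>, of s ?u]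
          Y1_lipschitz[OF \<alpha>, of m s] Y1_concat_at[of ?u ?u ?a \<alpha>] s m \<delta>
        by (auto simp: y_def)
      have c: "1 \<le> c_weight s" "c_weight s \<le> 6"
        using c_weight_bounds[of s] s m \<delta> by auto
      have "-1 \<le> \<alpha> s"
        using \<alpha> s m \<delta> by (auto simp: admissible_iff abs_le_iff)
      then have nonneg: "0 \<le> 1 + \<alpha> s"
        by simp
      have "?f s \<le> c_weight s * (2 * \<delta> - (1 + \<alpha> s) * Y1 \<alpha> s)"
        using near c by (intro mult_left_mono) (auto simp: algebra_simps)
      also have "\<dots> = c_weight s * (2 * \<delta>) - c_weight s * ((1 + \<alpha> s) * Y1 \<alpha> s)"
        by (simp add: algebra_simps)
      also have "\<dots> \<le> 6 * (2 * \<delta>) - 1 * ((1 + \<alpha> s) * (y / 2))"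
        using c near nonneg \<delta> y by (intro diff_mono mult_mono) auto
      finally show ?thesis
        by (simp add: algebra_simps)
    qed
    then have upper: "(LINT s:{m..<?u}|lborel. ?f s + y / 2 * \<alpha> s) \<le> (12 * \<delta> - y / 2) * (?u - m)"
      using int \<delta> by (intro set_integral_le_const) auto
    have sum: "(LINT s:{m..<?u}|lborel. ?f s + y / 2 * \<alpha> s)
        = (J m ?\<gamma> - J m \<alpha>) + y / 2 * (LINT s:{m..<?u}|lborel. \<alpha> s)"
      using J_concat_at_diff[OF a \<alpha>, of m ?u] m \<delta> int\<alpha> by (subst set_integral_add(2)) auto
    \<comment> \<open>The integral of \<open>\<alpha>\<close> is \<open>Y1 \<alpha> m - Y1 \<alpha> (m + \<delta>)\<close>, and \<open>m\<close> is a maximum of \<open>Y1 \<alpha>\<close>.\<close>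
    have "0 \<le> (LINT s:{m..<?u}|lborel. \<alpha> s)"
      using Y1_split[OF \<alpha>, of m ?u] max[of ?u] m \<delta> by auto
    then have "0 \<le> y / 2 * (LINT s:{m..<?u}|lborel. \<alpha> s)"
      using y by simp
    then have "J m ?\<gamma> - J m \<alpha> \<le> (12 * \<delta> - y / 2) * (?u - m)"
      using upper unfolding sum by linarith
    then have "J m ?\<gamma> - J m \<alpha> \<le> (12 * \<delta> - y / 2) * \<delta>"
      by simp
    then show ?thesis
      using \<delta> by (simp add: field_simps)
  qed
  have "ereal (- (y / 4)) < 0"
    using y by simp
  also have "0 \<le> Liminf (at_right 0)
      (\<lambda>\<delta>. ereal (1 / \<delta> * (J m (concat_at (m + \<delta>) ?a \<alpha>) - J m \<alpha>)))"
    using eq m1 a unfolding equilibrium_def by blast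
  finally have "\<forall>\<^sub>F \<delta> in at_right 0.
      ereal (- (y / 4)) < ereal (1 / \<delta> * (J m (concat_at (m + \<delta>) ?a \<alpha>) - J m \<alpha>))"
    by (rule less_LiminfD)
  \<comment> \<open>For \<open>\<delta> < y / 48\<close> the bound \<open>12 * \<delta> - y / 2\<close> is below \<open>- y / 4\<close>.\<close>
  moreover have "\<forall>\<^sub>F \<delta> in at_right 0. \<delta> \<in> {0 <..< min (1 - m) (y / 48)}"
    using m1 y by (intro eventually_at_right_real) auto
  ultimately have "\<forall>\<^sub>F \<delta> in at_right (0::real). False"
  proof eventually_elim
    case (elim \<delta>)
    then show False
      using bound[of \<delta>] y by auto
  qed
  then show False
    by simp
qed

lemma Y1_uminus: "Y1 (\<lambda>s. - \<alpha> s) t = - Y1 \<alpha> t"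
  by (simp add: Y1_def set_lebesgue_integral_def)

lemma J_uminus: "J t (\<lambda>s. - \<alpha> s) = J t \<alpha>"
  by (simp add: J_def Y2_def Y1_uminus)

lemma admissible_uminus:
  assumes "\<alpha> \<in> admissible"
  shows "(\<lambda>s. - \<alpha> s) \<in> admissible"
  using assms by (auto simp: admissible_iff set_borel_measurable_def)

text \<open>A deviation \<open>\<beta>\<close> from \<open>- \<alpha>\<close> costs as much as the deviation \<open>- \<beta>\<close> from \<open>\<alpha>\<close>.\<close>

lemma equilibrium_uminus:
  assumes "equilibrium \<alpha>"
  shows "equilibrium (\<lambda>s. - \<alpha> s)"
  unfolding equilibrium_def
proof (intro conjI ballI)
  show "(\<lambda>s. - \<alpha> s) \<in> admissible"
    using assms admissible_uminus by (simp add: equilibrium_def)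
  fix t :: real and \<beta>
  assume t: "t \<in> {0..<1}" and "\<beta> \<in> admissible"
  then have \<beta>: "(\<lambda>s. - \<beta> s) \<in> admissible"
    by (intro admissible_uminus)
  have "J t (concat_at u \<beta> (\<lambda>s. - \<alpha> s)) = J t (concat_at u (\<lambda>s. - \<beta> s) \<alpha>)" for u
    using J_uminus[of t "concat_at u (\<lambda>s. - \<beta> s) \<alpha>"] by (simp add: concat_at_def)
  then show "0 \<le> Liminf (at_right 0) (\<lambda>\<delta>. ereal (1 / \<delta> *
      (J t (concat_at (t + \<delta>) \<beta> (\<lambda>s. - \<alpha> s)) - J t (\<lambda>s. - \<alpha> s))))"
    using assms t \<beta> unfolding equilibrium_def J_uminus by simp
qed

lemma AE_eq_0_if_Y1_eq_0:
  assumes \<alpha>: "\<alpha> \<in> admissible" and zero: "\<And>s. s \<in> {0..1} \<Longrightarrow> Y1 \<alpha> s = 0"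
  shows "AE t in lborel. t \<in> {0..1} \<longrightarrow> \<alpha> t = 0"
proof -
  let ?f = "\<lambda>s. indicator {0..1} s *\<^sub>R \<alpha> s"
  have "integrable lborel ?f"
    using admissible_set_integrable[OF \<alpha>, of "{0..1}"] by (simp add: set_integrable_def)
  moreover have "(LINT s:{x<..}|lborel. ?f s) = 0" for x
  proof (cases "x < 1")
    case True
    have "(LINT s:{x<..}|lborel. ?f s) = Y1 \<alpha> (max x 0)"
      unfolding Y1_def set_lebesgue_integral_def
    proof (rule integral_cong_AE)
      show "AE s in lborel. indicator {x<..} s *\<^sub>R ?f s = indicator {max x 0..1} s *\<^sub>R \<alpha> s"
        \<comment> \<open>The integrands may differ at \<open>x\<close>, as the half-line excludes its endpoint.\<close>
        using AE_lborel_singleton[of x] by eventually_elim (auto simp: indicator_def)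
    next
      show "(\<lambda>s. indicator {x<..} s *\<^sub>R ?f s) \<in> borel_measurable lborel"
        using borel_measurable_integrable[OF \<open>integrable lborel ?f\<close>]
        by (rule borel_measurable_scaleR[rotated]) simp
    next
      show "(\<lambda>s. indicator {max x 0..1} s *\<^sub>R \<alpha> s) \<in> borel_measurable lborel"
        using admissible_set_integrable[OF \<alpha>, of "{max x 0..1}"]
        unfolding set_integrable_def by (intro borel_measurable_integrable) auto
    qed
    then show ?thesis
      using zero True by simp
  next
    case False
    then have "indicator {x<..} s *\<^sub>R ?f s = 0" for s
      by (auto simp: indicator_def)
    then show ?thesis
      by (simp only: set_lebesgue_integral_def Bochner_Integration.integral_zero)
  qed
  ultimately have "AE s in lborel. ?f s = 0"
    by (rule AE_eq_0_if_tail_integrals_0)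
  then show ?thesis
    by eventually_elim auto
qed

theorem proposition2p2:
  shows "equilibrium (\<lambda>_. 0) \<and>
    (\<forall>\<alpha>. equilibrium \<alpha> \<longrightarrow> (AE t in lborel. t \<in> {0..1} \<longrightarrow> \<alpha> t = 0))"
proof (intro conjI allI impI)
  show "equilibrium (\<lambda>_. 0)"
    by (rule equilibrium_zero)
next
  fix \<alpha>
  assume eq: "equilibrium \<alpha>"
  then have "\<alpha> \<in> admissible"
    by (simp add: equilibrium_def)
  moreover have "Y1 \<alpha> s = 0" if "s \<in> {0..1}" for s
    using equilibrium_Y1_nonpos[OF eq that] equilibrium_Y1_nonpos[OF equilibrium_uminus[OF eq] that]
    by (simp add: Y1_uminus)
  ultimately show "AE t in lborel. t \<in> {0..1} \<longrightarrow> \<alpha> t = 0"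
    by (rule AE_eq_0_if_Y1_eq_0)
qed

end
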